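(* Let $T\subseteq S\subseteq \mathbb{R}^n$ be semidefinite representable sets. Then the set $$(T\looparrowleft S) :=\bigcup_{z\in T}\ \bigcup_{F\in \mathcal{F}(z,S)}\operatorname{relint}(F)$$ is also semidefinite representable, where $\mathcal{F}(z,S)$ denotes the set of all faces of $S$ that contain $z$.
   Context: A linear matrix polynomial of dimension $k$ in $n$ variables is an expression $\mathscr{A}(X_1,\ldots,X_n)=A_0+X_1A_1+\cdots+X_nA_n$ with real symmetric $k\times k$ matrices $A_0,\ldots,A_n$. A spectrahedron in $\mathbb{R}^n$ is a set of the form $\{x\in\mathbb{R}^n\mid \mathscr{A}(x)\succeq 0\}$ for some linear matrix polynomial $\mathscr{A}$ in $n$ variables (of some dimension $k$), where $\succeq 0$ means positive semidefinite. A set $S\subseteq\mathbb{R}^n$ is semidefinite representable if it is the image of a spectrahedron under a linear projection, i.e. if $S=\{x\in\mathbb{R}^n\mid \exists y\in\mathbb{R}^m\ \mathscr{A}(x,y)\succeq 0\}$ for some $m\ge 0$ and some linear matrix polynomial $\mathscr{A}$ in $n+m$ variables. Semidefinite representable sets are convex, but need not be closed. A face of a convex set $S\subseteq\mathbb{R}^n$ is a nonempty convex subset $F\subseteq S$ such that for all $x,y\in S$ and $\lambda\in(0,1)$: if $\lambda x+(1-\lambda)y\in F$ then $x,y\in F$. (In particular a nonempty convex $S$ is a face of itself; faces need not be exposed.) The relative interior $\operatorname{relint}(F)$ of a convex set $F$ is the interior of $F$ in the affine hull of $F$. *)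

theory Defs
  imports "HOL-Analysis.Analysis" "Jordan_Normal_Form.Matrix"
begin

definition sym_mat :: "nat \<Rightarrow> real mat \<Rightarrow> bool" where
  "sym_mat k M \<longleftrightarrow> M \<in> carrier_mat k k \<and> transpose_mat M = M"

definition psd_mat :: "nat \<Rightarrow> real mat \<Rightarrow> bool" where
  "psd_mat k M \<longleftrightarrow> sym_mat k M \<and> (\<forall>v\<in>carrier_vec k. 0 \<le> scalar_prod v (M *\<^sub>v v))"

(* A linear matrix polynomial A0 + (SUM i:I. X_i * A i) of dimension k, whose variables X_i
   are indexed by a finite set I, is given by its constant term A0 and its coefficients A i. *)

definition lin_mat_poly :: "nat \<Rightarrow> 'i set \<Rightarrow> real mat \<Rightarrow> ('i \<Rightarrow> real mat) \<Rightarrow> bool" where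
  "lin_mat_poly k I A0 A \<longleftrightarrow> finite I \<and> sym_mat k A0 \<and> (\<forall>i\<in>I. sym_mat k (A i))"

(* The matrix sum is taken entrywise, since real mat has no additive monoid structure
   across different dimensions. *)

definition lmp_eval ::
  "nat \<Rightarrow> 'i set \<Rightarrow> real mat \<Rightarrow> ('i \<Rightarrow> real mat) \<Rightarrow> ('i \<Rightarrow> real) \<Rightarrow> real mat" where
  "lmp_eval k I A0 A x = mat k k (\<lambda>(r, c). A0 $$ (r, c) + (\<Sum>i\<in>I. x i * A i $$ (r, c)))"

(* The n + m variables are indexed by the disjoint sum of 'n and {..<m}; the point (x, y) of
   R^(n+m) is the function case_sum of the coordinate functions of x and y. *)

definition sd_representable :: "(real ^ 'n) set \<Rightarrow> bool" where
  "sd_representable S \<longleftrightarrow>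
     (\<exists>(m::nat) (k::nat) (A0 :: real mat) (A :: 'n + nat \<Rightarrow> real mat).
        lin_mat_poly k (UNIV <+> {..<m}) A0 A \<and>
        S = {x. \<exists>y\<in>carrier_vec m.
               psd_mat k (lmp_eval k (UNIV <+> {..<m}) A0 A (case_sum (vec_nth x) (vec_index y)))})"

definition faces_through :: "real ^ 'n \<Rightarrow> (real ^ 'n) set \<Rightarrow> (real ^ 'n) set set" where
  "faces_through z S = {F. F face_of S \<and> z \<in> F}"

definition face_extension :: "(real ^ 'n) set \<Rightarrow> (real ^ 'n) set \<Rightarrow> (real ^ 'n) set" where
  "face_extension T S = (\<Union>z\<in>T. \<Union>F\<in>faces_through z S. rel_interior F)"

end

theory Submission
  imports Defs
begin

text \<open>
  A point \<open>x\<close> lies in the relative interior of some face through \<open>z \<in> T\<close> exactly when the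
  segment from \<open>z\<close> to \<open>x\<close> can be prolonged beyond \<open>x\<close> without leaving \<open>S\<close>: a relative interior
  point of a face admits such a prolongation inside the face, and conversely the face whose
  relative interior contains \<open>x\<close> must contain both ends of any segment of \<open>S\<close> through \<open>x\<close>. Hence
  (\<open>face_extension_eq\<close>) the face extension is the set of all proper mixtures
  \<open>x = l w + (1 - l) z\<close> with \<open>w \<in> S\<close>, \<open>z \<in> T\<close>, \<open>0 < l < 1\<close>, a description in which the faces
  have disappeared.

  This description is not yet linear, because \<open>l\<close> multiplies \<open>w\<close> and \<open>z\<close>. The remedy is to quantify
  over \<open>u = l w\<close> instead of \<open>w\<close> and to homogenize the linear matrix inequalities of \<open>S\<close> and \<open>T\<close>:
  for \<open>t > 0\<close> the condition \<open>u \<in> t S\<close> is again a projected linear matrix inequality, jointly in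
  \<open>t\<close> and \<open>u\<close> (\<open>sd_representable_cone\<close>). Homogenization says nothing useful at \<open>t = 0\<close>, but both
  weights \<open>l\<close> and \<open>1 - l\<close> are strictly positive here, and strict positivity is itself a
  projection of a closed condition: \<open>t > 0\<close> holds if and only if the symmetric matrix with rows
  \<open>(t, 1)\<close> and \<open>(1, s)\<close> is positive semidefinite for some \<open>s\<close> (\<open>lmi_hyperbola\<close>). The conjunction
  of these inequalities, in block diagonal form, represents the face extension.
\<close>

section \<open>Convex geometry of the face extension\<close>

text \<open>
  The smallest face containing \<open>x\<close> works: were \<open>x\<close> on its relative boundary, a supporting
  hyperplane at \<open>x\<close> would cut out a strictly smaller face through \<open>x\<close>.
\<close>

lemma ex_face_of_rel_interior:
  fixes S :: "'a::euclidean_space set"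
  assumes "convex S" "x \<in> S"
  obtains F where "F face_of S" "x \<in> rel_interior F"
proof -
  define \<F> where "\<F> = {F. F face_of S \<and> x \<in> F}"
  define F where "F = \<Inter>\<F>"
  have S: "S \<in> \<F>"
    using assms by (simp add: \<F>_def face_of_refl)
  have face: "F face_of S"
    unfolding F_def using S by (intro face_of_Inter) (auto simp: \<F>_def)
  have xF: "x \<in> F"
    by (auto simp: F_def \<F>_def)
  have convF: "convex F"
    using face face_of_imp_convex by blast
  have "x \<in> rel_interior F"
  proof (rule ccontr)
    assume "x \<notin> rel_interior F"
    then obtain a where a: "\<And>y. y \<in> F \<Longrightarrow> inner a x \<le> inner a y"
        "\<And>y. y \<in> rel_interior F \<Longrightarrow> inner a x < inner a y"
      using supporting_hyperplane_rel_boundary [OF convF xF] by metis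
    have "(F \<inter> {y. inner a y = inner a x}) face_of F"
      using convF a(1) by (intro face_of_Int_supporting_hyperplane_ge) auto
    then have "(F \<inter> {y. inner a y = inner a x}) \<in> \<F>"
      using face face_of_trans xF by (auto simp: \<F>_def)
    then have "F \<subseteq> {y. inner a y = inner a x}"
      unfolding F_def by blast
    moreover obtain y where "y \<in> rel_interior F"
      using convF xF rel_interior_eq_empty by blast
    ultimately show False
      using a(2) rel_interior_subset by force
  qed
  with face show thesis ..
qed

text \<open>
  Relative interior points are those from which every segment of the face can be prolonged; this
  gives \<open>w\<close>. In the other direction the face property, applied to the open segment from \<open>z\<close> to \<open>w\<close>,
  puts \<open>z\<close> into the face that has \<open>x\<close> in its relative interior.
\<close>

lemma face_extension_eq:
  assumes "convex S" "T \<subseteq> S"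
  shows "face_extension T S =
    {x. \<exists>l w z. 0 < l \<and> l < 1 \<and> w \<in> S \<and> z \<in> T \<and> x = l *\<^sub>R w + (1 - l) *\<^sub>R z}"
    (is "_ = ?R")
proof (intro equalityI subsetI)
  fix x assume "x \<in> face_extension T S"
  then obtain z F where z: "z \<in> T" "F face_of S" "z \<in> F" "x \<in> rel_interior F"
    by (auto simp: face_extension_def faces_through_def)
  then have "convex F" "F \<subseteq> S"
    using face_of_imp_convex face_of_imp_subset by blast+
  then obtain e where e: "e > 1" "(1 - e) *\<^sub>R z + e *\<^sub>R x \<in> F"
    using convex_rel_interior_if2 [of F x] z hull_inc [of z F affine] by blast
  define w where "w = (1 - e) *\<^sub>R z + e *\<^sub>R x"
  have "x = (1 / e) *\<^sub>R w + (1 - 1 / e) *\<^sub>R z"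
    using e(1) by (simp add: w_def algebra_simps flip: scaleR_add_left)
  moreover have "w \<in> S" "0 < 1 / e" "1 / e < 1"
    using e \<open>F \<subseteq> S\<close> by (auto simp: w_def)
  ultimately show "x \<in> ?R"
    using z(1) by blast
next
  fix x assume "x \<in> ?R"
  then obtain l w z where x: "0 < l" "l < 1" "w \<in> S" "z \<in> T" "x = l *\<^sub>R w + (1 - l) *\<^sub>R z"
    by blast
  have "x \<in> S"
    using x assms convexD [of S w z l "1 - l"] by auto
  then obtain F where F: "F face_of S" "x \<in> rel_interior F"
    using ex_face_of_rel_interior assms(1) by blast
  have xF: "x \<in> F"
    using F rel_interior_subset by blast
  have "z \<in> F"
  proof (cases "w = z")
    case True
    then have "x = z"
      using x(5) by (simp flip: scaleR_add_left)
    with xF show ?thesis by simp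
  next
    case False
    then have "x \<in> open_segment z w"
      using x by (auto simp: in_segment add.commute)
    then show ?thesis
      using face_ofD [OF F(1)] x xF assms(2) by blast
  qed
  then show "x \<in> face_extension T S"
    using F x(4) by (auto simp: face_extension_def faces_through_def)
qed

section \<open>Affine functions of finitely many variables\<close>

definition affine_in :: "'i set \<Rightarrow> (('i \<Rightarrow> real) \<Rightarrow> real) \<Rightarrow> bool" where
  "affine_in I f \<longleftrightarrow> (\<exists>c C. \<forall>x. f x = c + (\<Sum>i\<in>I. C i * x i))"

lemma affine_in_const [simp]: "affine_in I (\<lambda>x. c)"
  unfolding affine_in_def by (rule exI [of _ c], rule exI [of _ "\<lambda>_. 0"]) simp

lemma affine_in_var [simp]:
  assumes "finite I" "i \<in> I"
  shows "affine_in I (\<lambda>x. x i)"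
  unfolding affine_in_def
  using assms by (intro exI [of _ 0] exI [of _ "\<lambda>j. if j = i then 1 else 0"])
    (simp add: if_distrib [of "\<lambda>a. a * _"] cong: if_cong)

lemma affine_in_add:
  assumes "affine_in I f" "affine_in I g"
  shows "affine_in I (\<lambda>x. f x + g x)"
proof -
  obtain c C d D where "\<And>x. f x = c + (\<Sum>i\<in>I. C i * x i)" "\<And>x. g x = d + (\<Sum>i\<in>I. D i * x i)"
    using assms unfolding affine_in_def by metis
  then show ?thesis
    unfolding affine_in_def
    by (intro exI [of _ "c + d"] exI [of _ "\<lambda>i. C i + D i"])
      (simp add: algebra_simps sum.distrib)
qed

lemma affine_in_cmult:
  assumes "affine_in I f"
  shows "affine_in I (\<lambda>x. a * f x)"
proof -
  obtain c C where "\<And>x. f x = c + (\<Sum>i\<in>I. C i * x i)"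
    using assms unfolding affine_in_def by metis
  then show ?thesis
    unfolding affine_in_def
    by (intro exI [of _ "a * c"] exI [of _ "\<lambda>i. a * C i"])
      (simp add: algebra_simps sum_distrib_left)
qed

lemma affine_in_diff:
  assumes "affine_in I f" "affine_in I g"
  shows "affine_in I (\<lambda>x. f x - g x)"
  using affine_in_add [OF assms(1) affine_in_cmult [OF assms(2), of "-1"]] by simp

lemma affine_in_sum:
  assumes "\<And>i. i \<in> I \<Longrightarrow> affine_in J (f i)"
  shows "affine_in J (\<lambda>x. \<Sum>i\<in>I. f i x)"
  using assms by (induction I rule: infinite_finite_induct) (auto intro: affine_in_add)

lemma affine_in_compose:
  assumes "affine_in I f" "\<And>i. i \<in> I \<Longrightarrow> affine_in J (\<lambda>x. L x i)"
  shows "affine_in J (\<lambda>x. f (L x))"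
proof -
  obtain c C where "\<And>x. f x = c + (\<Sum>i\<in>I. C i * x i)"
    using assms(1) unfolding affine_in_def by metis
  with assms(2) show ?thesis
    by (simp add: affine_in_add affine_in_sum affine_in_cmult)
qed

lemma affine_in_cong:
  assumes "affine_in I f" "\<And>i. i \<in> I \<Longrightarrow> x i = y i"
  shows "f x = f y"
  using assms unfolding affine_in_def by (metis (no_types, lifting) sum.cong)

lemma affine_in_convex_combination:
  assumes "affine_in I f"
  shows "f (\<lambda>i. s * x i + (1 - s) * y i) = s * f x + (1 - s) * f y"
proof -
  obtain c C where "\<And>x. f x = c + (\<Sum>i\<in>I. C i * x i)"
    using assms unfolding affine_in_def by metis
  then show ?thesis
    by (simp add: algebra_simps sum.distrib sum_distrib_left sum_subtractf)
qed

text \<open>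
  The coefficients of an affine function can be read off from its values at the origin and the
  unit vectors. Written in this way they depend on the function alone, so equal entries of a
  matrix of affine functions get equal coefficients and symmetry carries over to the
  coefficient matrices.
\<close>

lemma affine_in_expand:
  assumes "finite I" "affine_in I f"
  shows "f x = f (\<lambda>_. 0) + (\<Sum>i\<in>I. (f (\<lambda>j. if j = i then 1 else 0) - f (\<lambda>_. 0)) * x i)"
proof -
  obtain c C where f: "\<And>x. f x = c + (\<Sum>i\<in>I. C i * x i)"
    using assms unfolding affine_in_def by metis
  have "f (\<lambda>j. if j = i then 1 else 0) - f (\<lambda>_. 0) = C i" if "i \<in> I" for i
    using that assms(1) by (simp add: f if_distrib [of "\<lambda>a. _ * a"] cong: if_cong)
  then show ?thesis
    by (simp add: f cong: sum.cong)
qed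

section \<open>Linear matrix inequalities\<close>

definition qform :: "nat \<Rightarrow> (nat \<Rightarrow> nat \<Rightarrow> real) \<Rightarrow> (nat \<Rightarrow> real) \<Rightarrow> real" where
  "qform k M v = (\<Sum>r<k. \<Sum>c<k. v r * M r c * v c)"

text \<open>
  A linear matrix inequality, encoded as a symmetric matrix whose entries are affine functions of
  the variables rather than by its coefficient matrices. Substitution, block sums and
  homogenization then act on each entry separately, and the quadratic form needs no dimension
  checks on vectors.
\<close>

definition lmi :: "'i set \<Rightarrow> (('i \<Rightarrow> real) \<Rightarrow> bool) \<Rightarrow> bool" where
  "lmi I P \<longleftrightarrow> (\<exists>k E.
     (\<forall>r<k. \<forall>c<k. affine_in I (E r c) \<and> E r c = E c r) \<and>
     (\<forall>x. P x \<longleftrightarrow> (\<forall>v. 0 \<le> qform k (\<lambda>r c. E r c x) v)))"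

lemma lmiE:
  assumes "lmi I P"
  obtains k E where "\<And>r c. r < k \<Longrightarrow> c < k \<Longrightarrow> affine_in I (E r c)"
    "\<And>r c. r < k \<Longrightarrow> c < k \<Longrightarrow> E r c = E c r"
    "\<And>x. P x \<longleftrightarrow> (\<forall>v. 0 \<le> qform k (\<lambda>r c. E r c x) v)"
  using assms unfolding lmi_def by metis

lemma lmiI:
  assumes "\<And>r c. r < k \<Longrightarrow> c < k \<Longrightarrow> affine_in I (E r c)"
    "\<And>r c. r < k \<Longrightarrow> c < k \<Longrightarrow> E r c = E c r"
    "\<And>x. P x \<longleftrightarrow> (\<forall>v. 0 \<le> qform k (\<lambda>r c. E r c x) v)"
  shows "lmi I P"
  using assms unfolding lmi_def by blast

lemma qform_cong:
  assumes "\<And>r c. r < k \<Longrightarrow> c < k \<Longrightarrow> M r c = N r c" "\<And>r. r < k \<Longrightarrow> v r = w r"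
  shows "qform k M v = qform k N w"
  using assms unfolding qform_def by (intro sum.cong refl) auto

lemma psd_mat_iff_qform:
  assumes "\<And>r c. r < k \<Longrightarrow> c < k \<Longrightarrow> M r c = M c r"
  shows "psd_mat k (mat k k (\<lambda>(r, c). M r c)) \<longleftrightarrow> (\<forall>v. 0 \<le> qform k M v)"
proof -
  let ?M = "mat k k (\<lambda>(r, c). M r c)"
  have sym: "sym_mat k ?M"
    using assms by (auto simp: sym_mat_def transpose_mat_def)
  have form: "scalar_prod v (?M *\<^sub>v v) = qform k M (vec_index v)" if "v \<in> carrier_vec k" for v
    using that by (auto simp: scalar_prod_def qform_def sum_distrib_left mult.assoc
        lessThan_atLeast0 intro!: sum.cong)
  have "0 \<le> qform k M v" if "\<forall>u\<in>carrier_vec k. 0 \<le> qform k M (vec_index u)" for v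
  proof -
    have "0 \<le> qform k M (vec_index (vec k v))"
      using that by auto
    also have "\<dots> = qform k M v"
      by (rule qform_cong) auto
    finally show ?thesis .
  qed
  then show ?thesis
    using sym form by (auto simp: psd_mat_def)
qed

lemma lmi_iff_lin_mat_poly:
  assumes "finite I"
  shows "lmi I P \<longleftrightarrow> (\<exists>k A0 A. lin_mat_poly k I A0 A \<and>
           (\<forall>x. P x \<longleftrightarrow> psd_mat k (lmp_eval k I A0 A x)))"
proof
  assume "lmi I P"
  then obtain k E where E: "\<And>r c. r < k \<Longrightarrow> c < k \<Longrightarrow> affine_in I (E r c)"
    "\<And>r c. r < k \<Longrightarrow> c < k \<Longrightarrow> E r c = E c r"
    "\<And>x. P x \<longleftrightarrow> (\<forall>v. 0 \<le> qform k (\<lambda>r c. E r c x) v)"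
    by (rule lmiE) blast
  define A0 where "A0 = mat k k (\<lambda>(r, c). E r c (\<lambda>_. 0))"
  define A where "A i = mat k k (\<lambda>(r, c). E r c (\<lambda>j. if j = i then 1 else 0) - E r c (\<lambda>_. 0))" for i
  have "lin_mat_poly k I A0 A"
    using assms E(2) by (auto simp: lin_mat_poly_def sym_mat_def A0_def A_def)
  moreover have "lmp_eval k I A0 A x = mat k k (\<lambda>(r, c). E r c x)" for x
  proof (rule eq_matI)
    fix r c assume "r < dim_row (mat k k (\<lambda>(r, c). E r c x))" "c < dim_col (mat k k (\<lambda>(r, c). E r c x))"
    then have rc: "r < k" "c < k" by auto
    show "lmp_eval k I A0 A x $$ (r, c) = mat k k (\<lambda>(r, c). E r c x) $$ (r, c)"
      using rc by (simp add: lmp_eval_def A0_def A_def mult.commute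
          affine_in_expand [OF assms E(1) [OF rc], of x])
  qed (simp_all add: lmp_eval_def)
  then have "P x \<longleftrightarrow> psd_mat k (lmp_eval k I A0 A x)" for x
    using psd_mat_iff_qform [of k "\<lambda>r c. E r c x"] E(2,3) by simp
  ultimately show "\<exists>k A0 A. lin_mat_poly k I A0 A \<and>
           (\<forall>x. P x \<longleftrightarrow> psd_mat k (lmp_eval k I A0 A x))"
    by blast
next
  assume "\<exists>k A0 A. lin_mat_poly k I A0 A \<and> (\<forall>x. P x \<longleftrightarrow> psd_mat k (lmp_eval k I A0 A x))"
  then obtain k A0 A where A: "lin_mat_poly k I A0 A"
    "\<And>x. P x \<longleftrightarrow> psd_mat k (lmp_eval k I A0 A x)"
    by blast
  define E where "E r c x = A0 $$ (r, c) + (\<Sum>i\<in>I. x i * A i $$ (r, c))" for r c and x :: "'a \<Rightarrow> real"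
  have swap: "M $$ (r, c) = M $$ (c, r)" if "sym_mat k M" "r < k" "c < k" for M r c
    using that index_transpose_mat(1) [of c M r] by (auto simp: sym_mat_def)
  have sym: "E r c = E c r" if "r < k" "c < k" for r c
    using A(1) swap that by (auto simp: E_def lin_mat_poly_def)
  show "lmi I P"
  proof (rule lmiI)
    show "affine_in I (E r c)" for r c
      unfolding affine_in_def E_def
      by (intro exI [of _ "A0 $$ (r, c)"] exI [of _ "\<lambda>i. A i $$ (r, c)"]) (simp add: mult.commute)
    show "P x \<longleftrightarrow> (\<forall>v. 0 \<le> qform k (\<lambda>r c. E r c x) v)" for x
      using psd_mat_iff_qform [of k "\<lambda>r c. E r c x"] sym A(2) by (simp add: lmp_eval_def E_def)
  qed (use sym in auto)
qed

lemma lmi_cong: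
  assumes "lmi I P" "\<And>i. i \<in> I \<Longrightarrow> x i = y i"
  shows "P x \<longleftrightarrow> P y"
proof -
  obtain k E where E: "\<And>r c. r < k \<Longrightarrow> c < k \<Longrightarrow> affine_in I (E r c)"
    "\<And>x. P x \<longleftrightarrow> (\<forall>v. 0 \<le> qform k (\<lambda>r c. E r c x) v)"
    using assms(1) by (rule lmiE) blast
  have "qform k (\<lambda>r c. E r c x) v = qform k (\<lambda>r c. E r c y) v" for v
    using affine_in_cong [OF E(1) assms(2)] by (intro qform_cong) auto
  then show ?thesis
    by (simp add: E(2))
qed

lemma lmi_compose:
  assumes "lmi I P" "\<And>i. i \<in> I \<Longrightarrow> affine_in J (\<lambda>x. L x i)"
  shows "lmi J (\<lambda>x. P (L x))"
proof -
  obtain k E where E: "\<And>r c. r < k \<Longrightarrow> c < k \<Longrightarrow> affine_in I (E r c)"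
    "\<And>r c. r < k \<Longrightarrow> c < k \<Longrightarrow> E r c = E c r"
    "\<And>x. P x \<longleftrightarrow> (\<forall>v. 0 \<le> qform k (\<lambda>r c. E r c x) v)"
    using assms(1) by (rule lmiE) blast
  show ?thesis
  proof (rule lmiI [of k _ "\<lambda>r c x. E r c (L x)"])
    show "affine_in J (\<lambda>x. E r c (L x))" if "r < k" "c < k" for r c
      by (rule affine_in_compose [OF E(1) [OF that] assms(2)])
    show "(\<lambda>x. E r c (L x)) = (\<lambda>x. E c r (L x))" if "r < k" "c < k" for r c
      using E(2) [OF that] by simp
  qed (simp add: E(3))
qed

lemma lmi_convex:
  assumes "lmi I P" "P x" "P y" "0 \<le> s" "s \<le> 1"
  shows "P (\<lambda>i. s * x i + (1 - s) * y i)"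
proof -
  obtain k E where E: "\<And>r c. r < k \<Longrightarrow> c < k \<Longrightarrow> affine_in I (E r c)"
    "\<And>x. P x \<longleftrightarrow> (\<forall>v. 0 \<le> qform k (\<lambda>r c. E r c x) v)"
    using assms(1) by (rule lmiE) blast
  have "qform k (\<lambda>r c. E r c (\<lambda>i. s * x i + (1 - s) * y i)) v =
      qform k (\<lambda>r c. s * E r c x + (1 - s) * E r c y) v" for v
    by (intro qform_cong) (simp_all add: affine_in_convex_combination [OF E(1)])
  also have "\<dots> v = s * qform k (\<lambda>r c. E r c x) v + (1 - s) * qform k (\<lambda>r c. E r c y) v" for v
    unfolding qform_def sum_distrib_left sum.distrib [symmetric]
    by (intro sum.cong refl) (simp add: algebra_simps)
  finally show ?thesis
    using assms by (simp add: E(2))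
qed

lemma sum_lessThan_add:
  fixes f :: "nat \<Rightarrow> 'a::comm_monoid_add"
  shows "(\<Sum>i<k + l. f i) = (\<Sum>i<k. f i) + (\<Sum>i<l. f (k + i))"
  by (induction l) (simp_all add: add.assoc)

text \<open>
  Block diagonal sum: its quadratic form is the sum of the two forms in disjoint groups of vector
  coordinates, and setting one group to zero recovers each summand.
\<close>

lemma lmi_conj:
  assumes "lmi I P" "lmi I Q"
  shows "lmi I (\<lambda>x. P x \<and> Q x)"
proof -
  obtain k E where E: "\<And>r c. r < k \<Longrightarrow> c < k \<Longrightarrow> affine_in I (E r c)"
    "\<And>r c. r < k \<Longrightarrow> c < k \<Longrightarrow> E r c = E c r"
    "\<And>x. P x \<longleftrightarrow> (\<forall>v. 0 \<le> qform k (\<lambda>r c. E r c x) v)"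
    using assms(1) by (rule lmiE) blast
  obtain l D where D: "\<And>r c. r < l \<Longrightarrow> c < l \<Longrightarrow> affine_in I (D r c)"
    "\<And>r c. r < l \<Longrightarrow> c < l \<Longrightarrow> D r c = D c r"
    "\<And>x. Q x \<longleftrightarrow> (\<forall>v. 0 \<le> qform l (\<lambda>r c. D r c x) v)"
    using assms(2) by (rule lmiE) blast
  define B where "B r c = (if r < k \<and> c < k then E r c
      else if k \<le> r \<and> k \<le> c then D (r - k) (c - k) else (\<lambda>_. 0))" for r c
  have block: "qform (k + l) (\<lambda>r c. B r c x) v =
      qform k (\<lambda>r c. E r c x) v + qform l (\<lambda>r c. D r c x) (\<lambda>i. v (k + i))" for x v
    by (simp add: qform_def sum_lessThan_add B_def)
  show ?thesis
  proof (rule lmiI [of "k + l" _ B])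
    show "affine_in I (B r c)" if "r < k + l" "c < k + l" for r c
      using that E(1) D(1) by (auto simp: B_def)
    show "B r c = B c r" if "r < k + l" "c < k + l" for r c
      using that E(2) D(2) by (auto simp: B_def)
    show "(P x \<and> Q x) \<longleftrightarrow> (\<forall>v. 0 \<le> qform (k + l) (\<lambda>r c. B r c x) v)" (is "_ \<longleftrightarrow> ?B") for x
    proof
      assume "P x \<and> Q x"
      then show ?B
        by (simp add: block E(3) D(3))
    next
      assume B: ?B
      have "0 \<le> qform k (\<lambda>r c. E r c x) v" for v
      proof -
        have "qform k (\<lambda>r c. E r c x) (\<lambda>i. if i < k then v i else 0) = qform k (\<lambda>r c. E r c x) v"
          by (rule qform_cong) auto
        then show ?thesis
          using B [rule_format, of "\<lambda>i. if i < k then v i else 0"]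
          unfolding block by (simp add: qform_def)
      qed
      moreover have "0 \<le> qform l (\<lambda>r c. D r c x) v" for v
        using B [rule_format, of "\<lambda>i. if i < k then 0 else v (i - k)"]
        unfolding block by (simp add: qform_def)
      ultimately show "P x \<and> Q x"
        by (simp add: E(3) D(3))
    qed
  qed
qed

text \<open>
  The symmetric matrix with rows \<open>(f, 1)\<close> and \<open>(1, g)\<close> is positive semidefinite precisely on this
  set. Projecting away a free variable \<open>g\<close> leaves the strict inequality \<open>0 < f\<close>.
\<close>

lemma lmi_hyperbola:
  assumes "affine_in I f" "affine_in I g"
  shows "lmi I (\<lambda>x. 0 < f x \<and> 1 \<le> f x * g x)"
proof -
  define B where "B r c = (if r = 0 \<and> c = 0 then f else if r = 1 \<and> c = 1 then g else (\<lambda>_. 1))"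
    for r c :: nat
  have form: "qform 2 (\<lambda>r c. B r c x) v = f x * (v 0)\<^sup>2 + 2 * v 0 * v 1 + g x * (v 1)\<^sup>2" for x v
    by (simp add: qform_def B_def numeral_2_eq_2 power2_eq_square algebra_simps)
  show ?thesis
  proof (rule lmiI [of 2 _ B])
    show "affine_in I (B r c)" for r c
      using assms by (simp add: B_def)
    show "B r c = B c r" for r c
      by (simp add: B_def)
    show "(0 < f x \<and> 1 \<le> f x * g x) \<longleftrightarrow> (\<forall>v. 0 \<le> qform 2 (\<lambda>r c. B r c x) v)"
      (is "?L \<longleftrightarrow> ?R") for x
    proof
      assume L: ?L
      have "0 \<le> f x * qform 2 (\<lambda>r c. B r c x) v" for v
      proof -
        have "f x * qform 2 (\<lambda>r c. B r c x) v = (f x * v 0 + v 1)\<^sup>2 + (f x * g x - 1) * (v 1)\<^sup>2"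
          unfolding form by (simp add: power2_eq_square algebra_simps)
        with L show ?thesis by simp
      qed
      with L show ?R
        by (simp add: zero_le_mult_iff)
    next
      assume ?R
      then have R: "0 \<le> f x * a\<^sup>2 + 2 * a * b + g x * b\<^sup>2" for a b
        unfolding form by (auto dest: spec [of _ "\<lambda>i. if i = 0 then a else b"])
      have pos: "0 < f x"
      proof (rule ccontr)
        assume "\<not> 0 < f x"
        (* The vector (a, 1) is chosen so that the mixed and the last term of the form add up to -1. *)
        define a where "a = - ((g x + 1) / 2)"
        have "f x * a\<^sup>2 \<le> 0"
          using \<open>\<not> 0 < f x\<close> by (simp add: mult_nonpos_nonneg)
        moreover have "2 * a + g x = - 1"
          unfolding a_def by (simp add: field_simps)
        ultimately show False
          using R [of a 1] by simp
      qed
      have "0 \<le> f x * (f x * g x - 1)"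
        using R [of 1 "- f x"] by (simp add: power2_eq_square algebra_simps)
      with pos show ?L
        by (simp add: zero_le_mult_iff)
    qed
  qed
qed

text \<open>
  The new variable \<open>None\<close> multiplies the constant terms of all entries. For \<open>t > 0\<close> the
  homogenized matrix is \<open>t\<close> times the original one at \<open>x / t\<close>, and a positive factor does not
  affect semidefiniteness.
\<close>

lemma lmi_homogenize:
  assumes "finite I" "lmi I P"
  obtains H where "lmi (insert None (Some ` I)) H"
    "\<And>t x. 0 < t \<Longrightarrow> H (case_option t x) \<longleftrightarrow> P (\<lambda>i. x i / t)"
proof -
  obtain k E where E: "\<And>r c. r < k \<Longrightarrow> c < k \<Longrightarrow> affine_in I (E r c)"
    "\<And>r c. r < k \<Longrightarrow> c < k \<Longrightarrow> E r c = E c r"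
    "\<And>x. P x \<longleftrightarrow> (\<forall>v. 0 \<le> qform k (\<lambda>r c. E r c x) v)"
    using assms(2) by (rule lmiE) blast
  define D where "D r c z = E r c (\<lambda>_. 0) * z None +
      (\<Sum>i\<in>I. (E r c (\<lambda>j. if j = i then 1 else 0) - E r c (\<lambda>_. 0)) * z (Some i))" for r c z
  define H where "H z \<longleftrightarrow> (\<forall>v. 0 \<le> qform k (\<lambda>r c. D r c z) v)" for z
  have "lmi (insert None (Some ` I)) H"
  proof (rule lmiI [of k _ D])
    show "affine_in (insert None (Some ` I)) (D r c)" for r c
      unfolding D_def using assms(1)
      by (intro affine_in_add affine_in_sum affine_in_cmult affine_in_var) auto
    show "D r c = D c r" if "r < k" "c < k" for r c
      unfolding D_def using E(2) [OF that] by simp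
  qed (simp add: H_def)
  moreover have "H (case_option t x) \<longleftrightarrow> P (\<lambda>i. x i / t)" if t: "0 < t" for t x
  proof -
    have D: "D r c (case_option t x) = t * E r c (\<lambda>i. x i / t)" if "r < k" "c < k" for r c
      using affine_in_expand [OF assms(1) E(1) [OF that], of "\<lambda>i. x i / t"] t
      by (simp add: D_def algebra_simps sum_distrib_left)
    have "qform k (\<lambda>r c. D r c (case_option t x)) v =
        qform k (\<lambda>r c. t * E r c (\<lambda>i. x i / t)) v" for v
      by (intro qform_cong D refl)
    also have "\<dots> v = t * qform k (\<lambda>r c. E r c (\<lambda>i. x i / t)) v" for v
      by (simp add: qform_def sum_distrib_left mult_ac)
    finally show ?thesis
      using t by (simp add: H_def E(3) zero_le_mult_iff)
  qed
  ultimately show thesis ..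
qed

section \<open>Semidefinite representations by linear matrix inequalities\<close>

lemma sd_representableE:
  fixes S :: "(real ^ 'n) set"
  assumes "sd_representable S"
  obtains m :: nat and P where "lmi (UNIV <+> {..<m}) P" "S = {x. \<exists>y. P (case_sum (vec_nth x) y)}"
proof -
  obtain m k A0 and A :: "'n + nat \<Rightarrow> real mat" where A: "lin_mat_poly k (UNIV <+> {..<m}) A0 A"
    "S = {x. \<exists>y\<in>carrier_vec m.
       psd_mat k (lmp_eval k (UNIV <+> {..<m}) A0 A (case_sum (vec_nth x) (vec_index y)))}"
    using assms unfolding sd_representable_def by blast
  define P where "P z \<longleftrightarrow> psd_mat k (lmp_eval k (UNIV <+> {..<m}) A0 A z)" for z
  have lmi: "lmi (UNIV <+> {..<m}) P"
    using A(1) lmi_iff_lin_mat_poly [of "UNIV <+> {..<m}" P] unfolding P_def by auto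
  have "P (case_sum (vec_nth x) y) \<longleftrightarrow> P (case_sum (vec_nth x) (vec_index (vec m y)))" for x y
    by (intro lmi_cong [OF lmi]) auto
  then have "S = {x. \<exists>y. P (case_sum (vec_nth x) y)}"
    unfolding A(2) P_def by (metis vec_carrier)
  with lmi show thesis by (rule that)
qed

text \<open>
  Allowing an arbitrary finite set of projected variables makes it possible to give several groups
  of auxiliary variables their own names instead of packing them into one range of numbers.
\<close>

lemma sd_representableI:
  fixes S :: "(real ^ 'n) set" and J :: "'j set"
  assumes "finite J" "lmi (UNIV <+> J) P" "S = {x. \<exists>y. P (case_sum (vec_nth x) y)}"
  shows "sd_representable S"
proof -
  define m where "m = card J"
  obtain e where e: "bij_betw e J {..<m}"
    using ex_bij_betw_finite_nat [OF assms(1)] by (auto simp: m_def lessThan_atLeast0)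
  define Q where "Q z \<longleftrightarrow> P (case_sum (\<lambda>i. z (Inl i)) (\<lambda>j. z (Inr (e j))))" for z :: "'n + nat \<Rightarrow> real"
  have "e j < m" if "j \<in> J" for j
    using e that by (auto simp: bij_betw_def)
  then have lmi: "lmi (UNIV <+> {..<m}) Q"
    unfolding Q_def by (intro lmi_compose [OF assms(2)]) (auto intro!: affine_in_var)
  have "(\<exists>y. P (case_sum (vec_nth x) y)) \<longleftrightarrow>
      (\<exists>y\<in>carrier_vec m. Q (case_sum (vec_nth x) (vec_index y)))" for x
  proof
    assume "\<exists>y. P (case_sum (vec_nth x) y)"
    then obtain y where y: "P (case_sum (vec_nth x) y)" ..
    have "Q (case_sum (vec_nth x) (vec_index (vec m (\<lambda>i. y (the_inv_into J e i))))) \<longleftrightarrow>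
        P (case_sum (vec_nth x) y)"
      unfolding Q_def using e \<open>\<And>j. j \<in> J \<Longrightarrow> e j < m\<close>
      by (intro lmi_cong [OF assms(2)]) (auto simp: bij_betw_def the_inv_into_f_f)
    with y show "\<exists>y\<in>carrier_vec m. Q (case_sum (vec_nth x) (vec_index y))"
      by (metis vec_carrier)
  qed (auto simp: Q_def)
  moreover obtain k A0 A where "lin_mat_poly k (UNIV <+> {..<m}) A0 A"
    "\<And>z. Q z \<longleftrightarrow> psd_mat k (lmp_eval k (UNIV <+> {..<m}) A0 A z)"
    using lmi lmi_iff_lin_mat_poly [of "UNIV <+> {..<m}" Q] by auto
  ultimately show ?thesis
    unfolding sd_representable_def assms(3)
    by (intro exI [of _ m] exI [of _ k] exI [of _ A0] exI [of _ A]) simp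
qed

lemma sd_representable_imp_convex:
  assumes "sd_representable S"
  shows "convex S"
proof -
  obtain m :: nat and P where P: "lmi (UNIV <+> {..<m}) P" and S: "S = {x. \<exists>y. P (case_sum (vec_nth x) y)}"
    using assms by (rule sd_representableE)
  have "(1 - s) *\<^sub>R x' + s *\<^sub>R x \<in> S" if x: "x \<in> S" "x' \<in> S" and s: "0 \<le> s" "s \<le> 1" for x x' s
  proof -
    obtain y y' where y: "P (case_sum (vec_nth x) y)" "P (case_sum (vec_nth x') y')"
      using x by (auto simp: S)
    have "(\<lambda>i. s * case_sum (vec_nth x) y i + (1 - s) * case_sum (vec_nth x') y' i) =
        case_sum (vec_nth ((1 - s) *\<^sub>R x' + s *\<^sub>R x)) (\<lambda>j. s * y j + (1 - s) * y' j)"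
      by (auto split: sum.split)
    moreover have "P (\<lambda>i. s * case_sum (vec_nth x) y i + (1 - s) * case_sum (vec_nth x') y' i)"
      by (rule lmi_convex [OF P]) (fact y s)+
    ultimately show ?thesis
      by (auto simp: S)
  qed
  then show ?thesis
    by (simp add: convex_alt)
qed

text \<open>
  The auxiliary variables are scaled along with \<open>x\<close>. As they are existentially quantified and
  division by \<open>t\<close> is a bijection, this does not change the projection.
\<close>

lemma sd_representable_cone:
  fixes S :: "(real ^ 'n) set"
  assumes "sd_representable S"
  obtains m :: nat and H where "lmi (insert None (Some ` (UNIV <+> {..<m}))) H"
    "\<And>t x. 0 < t \<Longrightarrow> (1 / t) *\<^sub>R x \<in> S \<longleftrightarrow> (\<exists>y. H (case_option t (case_sum (vec_nth x) y)))"
proof -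
  obtain m :: nat and P where P: "lmi (UNIV <+> {..<m}) P" and S: "S = {x. \<exists>y. P (case_sum (vec_nth x) y)}"
    using assms by (rule sd_representableE)
  obtain H where H: "lmi (insert None (Some ` (UNIV <+> {..<m}))) H"
    "\<And>t x. 0 < t \<Longrightarrow> H (case_option t x) \<longleftrightarrow> P (\<lambda>i. x i / t)"
    using lmi_homogenize [OF _ P] by auto
  have "(1 / t) *\<^sub>R x \<in> S \<longleftrightarrow> (\<exists>y. H (case_option t (case_sum (vec_nth x) y)))" if t: "0 < t" for t x
  proof -
    have scale: "(\<lambda>i. case_sum (vec_nth x) y i / t) =
        case_sum (vec_nth ((1 / t) *\<^sub>R x)) (\<lambda>j. y j / t)" for y :: "nat \<Rightarrow> real"
      by (auto split: sum.split)
    have "(\<exists>y. H (case_option t (case_sum (vec_nth x) y))) \<longleftrightarrow>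
        (\<exists>y. P (case_sum (vec_nth ((1 / t) *\<^sub>R x)) (\<lambda>j. y j / t)))"
      by (simp only: H(2) [OF t] scale)
    also have "\<dots> \<longleftrightarrow> (\<exists>y. P (case_sum (vec_nth ((1 / t) *\<^sub>R x)) y))"
    proof
      assume "\<exists>y. P (case_sum (vec_nth ((1 / t) *\<^sub>R x)) y)"
      then obtain y where "P (case_sum (vec_nth ((1 / t) *\<^sub>R x)) y)" ..
      then show "\<exists>y. P (case_sum (vec_nth ((1 / t) *\<^sub>R x)) (\<lambda>j. y j / t))"
        using t by (intro exI [of _ "\<lambda>j. t * y j"]) simp
    qed blast
    finally show ?thesis by (simp add: S)
  qed
  with H(1) show thesis by (rule that)
qed

section \<open>The representation of the face extension\<close>

text \<open>
  The projected variables of a mixture \<open>x = u + (x - u)\<close> with \<open>u = l w\<close> and \<open>x - u = (1 - l) z\<close>: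
  \<open>Part\<close> holds \<open>u\<close> and \<open>Weight\<close> holds \<open>l\<close>; the lifts are the auxiliary variables in the cones over
  \<open>S\<close> and \<open>T\<close>; the bounds are the partners of \<open>l\<close> and \<open>1 - l\<close> in the hyperbola constraints
  that make these weights positive.
\<close>

datatype 'n hidden = Part 'n | Left_Lift nat | Right_Lift nat | Weight | Left_Bound | Right_Bound

lemma sd_representable_open_mixtures:
  fixes S T :: "(real ^ 'n) set"
  assumes "sd_representable S" "sd_representable T"
  shows "sd_representable
    {x. \<exists>l w z. 0 < l \<and> l < 1 \<and> w \<in> S \<and> z \<in> T \<and> x = l *\<^sub>R w + (1 - l) *\<^sub>R z}"
proof -
  obtain m :: nat and G where G: "lmi (insert None (Some ` (UNIV <+> {..<m}))) G"
    "\<And>t x. 0 < t \<Longrightarrow> (1 / t) *\<^sub>R x \<in> S \<longleftrightarrow> (\<exists>y. G (case_option t (case_sum (vec_nth x) y)))"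
    using sd_representable_cone [OF assms(1)] by blast
  obtain n :: nat and H where H: "lmi (insert None (Some ` (UNIV <+> {..<n}))) H"
    "\<And>t x. 0 < t \<Longrightarrow> (1 / t) *\<^sub>R x \<in> T \<longleftrightarrow> (\<exists>y. H (case_option t (case_sum (vec_nth x) y)))"
    using sd_representable_cone [OF assms(2)] by blast
  define J :: "'n hidden set" where "J = range Part \<union> Left_Lift ` {..<m} \<union> Right_Lift ` {..<n} \<union>
      {Weight, Left_Bound, Right_Bound}"
  let ?I = "UNIV <+> J :: ('n + 'n hidden) set"
  have fin: "finite J" "finite ?I"
    by (auto simp: J_def)
  define P :: "('n + 'n hidden \<Rightarrow> real) \<Rightarrow> bool" where "P q \<longleftrightarrow>
      (0 < q (Inr Weight) \<and> 1 \<le> q (Inr Weight) * q (Inr Left_Bound)) \<and>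
      (0 < 1 - q (Inr Weight) \<and> 1 \<le> (1 - q (Inr Weight)) * q (Inr Right_Bound)) \<and>
      G (case_option (q (Inr Weight))
        (case_sum (\<lambda>i. q (Inr (Part i))) (\<lambda>j. q (Inr (Left_Lift j))))) \<and>
      H (case_option (1 - q (Inr Weight))
        (case_sum (\<lambda>i. q (Inl i) - q (Inr (Part i))) (\<lambda>j. q (Inr (Right_Lift j)))))" for q
  have affine: "affine_in ?I (\<lambda>q. q (Inl i))" "affine_in ?I (\<lambda>q. q (Inr (Part i)))"
    "affine_in ?I (\<lambda>q. q (Inr Weight))"
    "affine_in ?I (\<lambda>q. q (Inr Left_Bound))" "affine_in ?I (\<lambda>q. q (Inr Right_Bound))"
    "j < m \<Longrightarrow> affine_in ?I (\<lambda>q. q (Inr (Left_Lift j)))"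
    "j < n \<Longrightarrow> affine_in ?I (\<lambda>q. q (Inr (Right_Lift j)))" for i j
    by (rule affine_in_var [OF fin(2)], force simp: J_def)+
  have lmi: "lmi ?I P"
    unfolding P_def
    by (intro lmi_conj [OF lmi_hyperbola] lmi_conj [OF lmi_compose [OF G(1)]]
        lmi_compose [OF H(1)]) (auto intro!: affine affine_in_diff)
  have "(\<exists>l w z. 0 < l \<and> l < 1 \<and> w \<in> S \<and> z \<in> T \<and> x = l *\<^sub>R w + (1 - l) *\<^sub>R z) \<longleftrightarrow>
      (\<exists>y. P (case_sum (vec_nth x) y))" (is "?L \<longleftrightarrow> ?R") for x
  proof
    assume ?L
    then obtain l w z where l: "0 < l" "l < 1" and wz: "w \<in> S" "z \<in> T"
      and x: "x = l *\<^sub>R w + (1 - l) *\<^sub>R z"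
      by blast
    obtain y where y: "G (case_option l (case_sum (vec_nth (l *\<^sub>R w)) y))"
      using G(2) [of l "l *\<^sub>R w"] l wz by auto
    obtain y' where y': "H (case_option (1 - l) (case_sum (vec_nth ((1 - l) *\<^sub>R z)) y'))"
      using H(2) [of "1 - l" "(1 - l) *\<^sub>R z"] l wz by auto
    have diff: "(\<lambda>i. vec_nth x i - vec_nth (l *\<^sub>R w) i) = vec_nth ((1 - l) *\<^sub>R z)"
      by (rule ext) (simp add: x)
    have "P (case_sum (vec_nth x)
        (case_hidden (vec_nth (l *\<^sub>R w)) y y' l (1 / l) (1 / (1 - l))))"
      unfolding P_def using l y y' by (simp add: diff del: vector_scaleR_component)
    then show ?R by blast
  next
    assume ?R
    then obtain y where y: "P (case_sum (vec_nth x) y)" ..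
    define l where "l = y Weight"
    define u where "u = (\<chi> i. y (Part i))"
    have l: "0 < l" "l < 1"
      using y by (auto simp: P_def l_def)
    have "(\<lambda>i. y (Part i)) = vec_nth u" "(\<lambda>i. vec_nth x i - y (Part i)) = vec_nth (x - u)"
      by (auto simp: u_def)
    then have "G (case_option l (case_sum (vec_nth u) (\<lambda>j. y (Left_Lift j))))"
      "H (case_option (1 - l) (case_sum (vec_nth (x - u)) (\<lambda>j. y (Right_Lift j))))"
      using y by (simp_all add: P_def l_def)
    then have "(1 / l) *\<^sub>R u \<in> S" "(1 / (1 - l)) *\<^sub>R (x - u) \<in> T"
      using G(2) H(2) l by (metis, metis diff_gt_0_iff_gt)
    moreover have "x = l *\<^sub>R ((1 / l) *\<^sub>R u) + (1 - l) *\<^sub>R ((1 / (1 - l)) *\<^sub>R (x - u))"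
      using l by simp
    ultimately show ?L
      using l by blast
  qed
  then show ?thesis
    by (intro sd_representableI [OF fin(1) lmi]) auto
qed

theorem theorem3p8:
  fixes S T :: "(real ^ 'n) set"
  assumes "sd_representable S"
    and "sd_representable T"
    and "T \<subseteq> S"
  shows "sd_representable (face_extension T S)"
  using sd_representable_open_mixtures [OF assms(1,2)]
  unfolding face_extension_eq [OF sd_representable_imp_convex [OF assms(1)] assms(3)] .

end
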